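(* Let $(\hat{\boldsymbol\theta},\hat{\boldsymbol\gamma})\in\mathcal S_\Theta\times\mathcal S_\Gamma$, let $i\in\{1,\dots,N\}$ be an agent of the score graph, and let $\boldsymbol y_{N_i}$ be the vector of observed scores given to and given by agent $i$, where $\mathbb P(\boldsymbol Y_{N_i}=\boldsymbol y_{N_i};\hat{\boldsymbol\gamma},\hat{\boldsymbol\theta})>0$. Define $$u_i(c_\ell):=\mathbb P(X_i=c_\ell\mid \boldsymbol Y_{N_i}=\boldsymbol y_{N_i};\hat{\boldsymbol\gamma},\hat{\boldsymbol\theta}),\qquad \ell=1,\dots,C.$$ Then, for every $\ell=1,\dots,C$, $$u_i(c_\ell)=\frac{v_i(c_\ell)}{Z_i},\qquad Z_i=\sum_{\ell=1}^C v_i(c_\ell),\qquad v_i(c_\ell)=p_\ell(\hat{\boldsymbol\gamma})\,\pi_i^{\leftrightarrow}(c_\ell)\,\pi_i^{\leftarrow}(c_\ell)\,\pi_i^{\rightarrow}(c_\ell),$$ where $$\pi_i^{\leftrightarrow}(c_\ell)=\prod_{h,k=1}^{R}\Big(\sum_{m=1}^C p_{k|m,\ell}(\hat{\boldsymbol\theta})\,p_{h|\ell,m}(\hat{\boldsymbol\theta})\,p_m(\hat{\boldsymbol\gamma})\Big)^{n_i^{\leftrightarrow}(h,k)},$$ $$\pi_i^{\leftarrow}(c_\ell)=\prod_{h=1}^{R}\Big(\sum_{m=1}^C p_{h|m,\ell}(\hat{\boldsymbol\theta})\,p_m(\hat{\boldsymbol\gamma})\Big)^{n_i^{\leftarrow}(h)},\qquad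 \pi_i^{\rightarrow}(c_\ell)=\prod_{h=1}^{R}\Big(\sum_{m=1}^C p_{h|\ell,m}(\hat{\boldsymbol\theta})\,p_m(\hat{\boldsymbol\gamma})\Big)^{n_i^{\rightarrow}(h)}.$$
   Context: Score graph: $G_S=(\{1,\dots,N\},E_S)$ is a digraph without self-loops; $(i,j)\in E_S$ means that agent $i$ evaluates agent $j$. Every node has at least one incoming edge. States take values in a finite set $\mathcal C=\{c_1,\dots,c_C\}$ with $C$ elements and scores in a finite set $\mathcal R=\{r_1,\dots,r_R\}$ with $R$ elements. Probabilistic model: each agent $i$ has a random state $X_i\in\mathcal C$ and each edge $(i,j)\in E_S$ has a random score $Y_{ij}\in\mathcal R$ (given by $i$ to $j$), with realization $y_{ij}$. The joint law, depending on a parameter $\boldsymbol\theta$ and a hyperparameter $\boldsymbol\gamma$, factorizes as $$\mathbb P\big((Y_{ij})_{(i,j)\in E_S},X_1,\dots,X_N\big)=\Big(\prod_{(i,j)\in E_S}\mathbb P(Y_{ij}\mid X_i,X_j)\Big)\Big(\prod_{i=1}^N\mathbb P(X_i)\Big),$$ where, for all $(i,j)\in E_S$ and all $i$ respectively, $\mathbb P(Y_{ij}=r_h\mid X_i=c_\ell,X_j=c_m;\boldsymbol\theta)=p_{h|\ell,m}(\boldsymbol\theta)$ and $\mathbb P(X_i=c_\ell;\boldsymbol\gamma)=p_\ell(\boldsymbol\gamma)$, with given continuous functions $p_{h|\ell,m}$ on a set $\Theta$ and $p_\ell$ on a set $\Gamma$. The feasible sets are $\mathcal S_\Theta=\{\boldsymbol\theta\in\Theta: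 p_{h|\ell,m}(\boldsymbol\theta)\in[0,1],\ \sum_{h=1}^R p_{h|\ell,m}(\boldsymbol\theta)=1\ \text{for all } h,\ell,m\}$ and $\mathcal S_\Gamma=\{\boldsymbol\gamma\in\Gamma: p_\ell(\boldsymbol\gamma)\in[0,1]\ \text{for all }\ell,\ \sum_{\ell=1}^C p_\ell(\boldsymbol\gamma)=1\}$. Local data: $\boldsymbol Y_{N_i}$ is the stacked vector of all $Y_{ji}$ with $(j,i)\in E_S$ and all $Y_{ij}$ with $(i,j)\in E_S$; $\boldsymbol y_{N_i}$ is its realization. Define $N_i^{\leftrightarrow}=\{j:(j,i)\in E_S,(i,j)\in E_S\}$, $N_i^{\leftarrow}=\{j:(j,i)\in E_S,(i,j)\notin E_S\}$, $N_i^{\rightarrow}=\{j:(i,j)\in E_S,(j,i)\notin E_S\}$, and, for $h,k=1,\dots,R$, $n_i^{\leftrightarrow}(h,k)=|\{j\in N_i^{\leftrightarrow}:y_{ij}=r_h,\,y_{ji}=r_k\}|$, $n_i^{\leftarrow}(h)=|\{j\in N_i^{\leftarrow}:y_{ji}=r_h\}|$, $n_i^{\rightarrow}(h)=|\{j\in N_i^{\rightarrow}:y_{ij}=r_h\}|$. Convention: $0^0=1$. *)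

theory Defs
  imports "HOL-Probability.Probability"
begin

text \<open>
  States and scores are enumerated by \<open>c\<close> on \<open>{1..nC}\<close> and by \<open>r\<close> on \<open>{1..nR}\<close>.
  \<open>ph h l m \<theta>\<close> is the conditional probability of score \<open>r h\<close> given evaluator state \<open>c l\<close>
  and evaluated state \<open>c m\<close>; \<open>pl l \<gamma>\<close> is the prior probability of state \<open>c l\<close>.
  An edge \<open>(i, j)\<close> means that \<open>i\<close> evaluates \<open>j\<close>; its score is \<open>Y (i, j)\<close>.
\<close>

definition feasible_Theta ::
  "nat \<Rightarrow> nat \<Rightarrow> 't set \<Rightarrow> (nat \<Rightarrow> nat \<Rightarrow> nat \<Rightarrow> 't \<Rightarrow> real) \<Rightarrow> 't set" where
  "feasible_Theta nC nR \<Theta> ph =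
     {\<theta> \<in> \<Theta>. \<forall>l\<in>{1..nC}. \<forall>m\<in>{1..nC}.
        (\<forall>h\<in>{1..nR}. ph h l m \<theta> \<in> {0..1}) \<and> (\<Sum>h=1..nR. ph h l m \<theta>) = 1}"

definition feasible_Gamma :: "nat \<Rightarrow> 'g set \<Rightarrow> (nat \<Rightarrow> 'g \<Rightarrow> real) \<Rightarrow> 'g set" where
  "feasible_Gamma nC \<Gamma> pl =
     {\<gamma> \<in> \<Gamma>. (\<forall>l\<in>{1..nC}. pl l \<gamma> \<in> {0..1}) \<and> (\<Sum>l=1..nC. pl l \<gamma>) = 1}"

locale score_graph =
  fixes N :: nat and E :: "(nat \<times> nat) set"
  assumes edges: "E \<subseteq> {1..N} \<times> {1..N}"
    and no_loops: "irrefl E"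
    and incoming: "\<And>i. i \<in> {1..N} \<Longrightarrow> \<exists>j. (j, i) \<in> E"

text \<open>
  \<open>M \<theta> \<gamma>\<close> is the probability measure belonging to the parameters \<open>\<theta>\<close> and \<open>\<gamma>\<close>.
  The conditional law of a score is prescribed only where the conditioning event has positive
  probability; on a null event the library's \<open>cond_prob\<close> is \<open>0\<close>, and both sides of
  \<open>joint_law\<close> vanish as soon as one of its conditioning events is null.
\<close>

locale score_model = score_graph N E
  for N :: nat and E :: "(nat \<times> nat) set" +
  fixes nC :: nat and c :: "nat \<Rightarrow> 's"
    and nR :: nat and r :: "nat \<Rightarrow> 'r"
    and \<Theta> :: "'t::topological_space set" and ph :: "nat \<Rightarrow> nat \<Rightarrow> nat \<Rightarrow> 't \<Rightarrow> real"
    and \<Gamma> :: "'g::topological_space set" and pl :: "nat \<Rightarrow> 'g \<Rightarrow> real"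
    and M :: "'t \<Rightarrow> 'g \<Rightarrow> 'w measure"
    and X :: "nat \<Rightarrow> 'w \<Rightarrow> 's" and Y :: "nat \<times> nat \<Rightarrow> 'w \<Rightarrow> 'r"
  assumes states: "inj_on c {1..nC}"
    and scores: "inj_on r {1..nR}"
    and cont_ph: "\<And>h l m. \<lbrakk>h \<in> {1..nR}; l \<in> {1..nC}; m \<in> {1..nC}\<rbrakk>
          \<Longrightarrow> continuous_on \<Theta> (ph h l m)"
    and cont_pl: "\<And>l. l \<in> {1..nC} \<Longrightarrow> continuous_on \<Gamma> (pl l)"
    and prob: "\<And>\<theta> \<gamma>. \<lbrakk>\<theta> \<in> feasible_Theta nC nR \<Theta> ph; \<gamma> \<in> feasible_Gamma nC \<Gamma> pl\<rbrakk>
          \<Longrightarrow> prob_space (M \<theta> \<gamma>)"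
    and rv_X: "\<And>\<theta> \<gamma> i. \<lbrakk>\<theta> \<in> feasible_Theta nC nR \<Theta> ph; \<gamma> \<in> feasible_Gamma nC \<Gamma> pl;
          i \<in> {1..N}\<rbrakk> \<Longrightarrow> X i \<in> measurable (M \<theta> \<gamma>) (count_space (c ` {1..nC}))"
    and rv_Y: "\<And>\<theta> \<gamma> e. \<lbrakk>\<theta> \<in> feasible_Theta nC nR \<Theta> ph; \<gamma> \<in> feasible_Gamma nC \<Gamma> pl;
          e \<in> E\<rbrakk> \<Longrightarrow> Y e \<in> measurable (M \<theta> \<gamma>) (count_space (r ` {1..nR}))"
    and state_law: "\<And>\<theta> \<gamma> i l. \<lbrakk>\<theta> \<in> feasible_Theta nC nR \<Theta> ph; \<gamma> \<in> feasible_Gamma nC \<Gamma> pl;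
          i \<in> {1..N}; l \<in> {1..nC}\<rbrakk> \<Longrightarrow> \<P>(\<omega> in M \<theta> \<gamma>. X i \<omega> = c l) = pl l \<gamma>"
    and score_law: "\<And>\<theta> \<gamma> i j h l m.
          \<lbrakk>\<theta> \<in> feasible_Theta nC nR \<Theta> ph; \<gamma> \<in> feasible_Gamma nC \<Gamma> pl;
          (i, j) \<in> E; h \<in> {1..nR}; l \<in> {1..nC}; m \<in> {1..nC};
          \<P>(\<omega> in M \<theta> \<gamma>. X i \<omega> = c l \<and> X j \<omega> = c m) > 0\<rbrakk>
          \<Longrightarrow> \<P>(\<omega> in M \<theta> \<gamma>. Y (i, j) \<omega> = r h \<bar> X i \<omega> = c l \<and> X j \<omega> = c m) = ph h l m \<theta>"
    and joint_law: "\<And>\<theta> \<gamma> x y. \<lbrakk>\<theta> \<in> feasible_Theta nC nR \<Theta> ph; \<gamma> \<in> feasible_Gamma nC \<Gamma> pl;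
          x \<in> {1..N} \<rightarrow> c ` {1..nC}; y \<in> E \<rightarrow> r ` {1..nR}\<rbrakk>
          \<Longrightarrow> \<P>(\<omega> in M \<theta> \<gamma>. (\<forall>e\<in>E. Y e \<omega> = y e) \<and> (\<forall>i\<in>{1..N}. X i \<omega> = x i)) =
            (\<Prod>(i, j)\<in>E. \<P>(\<omega> in M \<theta> \<gamma>. Y (i, j) \<omega> = y (i, j)
                            \<bar> X i \<omega> = x i \<and> X j \<omega> = x j)) *
            (\<Prod>i=1..N. \<P>(\<omega> in M \<theta> \<gamma>. X i \<omega> = x i))"

definition local_edges :: "(nat \<times> nat) set \<Rightarrow> nat \<Rightarrow> (nat \<times> nat) set" where
  "local_edges E i = {(a, b) \<in> E. b = i \<or> a = i}"

text \<open>The stacked vector of local scores, as an extensional function on the local edges.\<close>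

definition local_scores ::
  "(nat \<times> nat) set \<Rightarrow> nat \<Rightarrow> (nat \<times> nat \<Rightarrow> 'w \<Rightarrow> 'r) \<Rightarrow> 'w \<Rightarrow> (nat \<times> nat \<Rightarrow> 'r)" where
  "local_scores E i Y \<omega> = (\<lambda>e\<in>local_edges E i. Y e \<omega>)"

definition nbrs_both :: "(nat \<times> nat) set \<Rightarrow> nat \<Rightarrow> nat set" where
  "nbrs_both E i = {j. (j, i) \<in> E \<and> (i, j) \<in> E}"

definition nbrs_in :: "(nat \<times> nat) set \<Rightarrow> nat \<Rightarrow> nat set" where
  "nbrs_in E i = {j. (j, i) \<in> E \<and> (i, j) \<notin> E}"

definition nbrs_out :: "(nat \<times> nat) set \<Rightarrow> nat \<Rightarrow> nat set" where
  "nbrs_out E i = {j. (i, j) \<in> E \<and> (j, i) \<notin> E}"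

definition count_both ::
  "(nat \<times> nat) set \<Rightarrow> (nat \<Rightarrow> 'r) \<Rightarrow> (nat \<times> nat \<Rightarrow> 'r) \<Rightarrow> nat \<Rightarrow> nat \<Rightarrow> nat \<Rightarrow> nat" where
  "count_both E r y i h k = card {j \<in> nbrs_both E i. y (i, j) = r h \<and> y (j, i) = r k}"

definition count_in ::
  "(nat \<times> nat) set \<Rightarrow> (nat \<Rightarrow> 'r) \<Rightarrow> (nat \<times> nat \<Rightarrow> 'r) \<Rightarrow> nat \<Rightarrow> nat \<Rightarrow> nat" where
  "count_in E r y i h = card {j \<in> nbrs_in E i. y (j, i) = r h}"

definition count_out ::
  "(nat \<times> nat) set \<Rightarrow> (nat \<Rightarrow> 'r) \<Rightarrow> (nat \<times> nat \<Rightarrow> 'r) \<Rightarrow> nat \<Rightarrow> nat \<Rightarrow> nat" where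
  "count_out E r y i h = card {j \<in> nbrs_out E i. y (i, j) = r h}"

end

theory Submission
  imports Defs
begin

text \<open>
  The factorised joint law does not state that the agents' states are independent. It follows by
  counting mass: summing out the scores gives each state profile either the product of its priors or
  (when an edge has a null conditioning event) zero. Both the profile probabilities and the products
  of priors sum to 1, so the second case only occurs where the product vanishes. Hence the joint law
  is the full product; the scores away from \<open>i\<close> sum out to 1, and conditionally on \<open>X i\<close> the
  remaining sum over the other states factorises over the agents.
\<close>

declare One_nat_def [simp del] \<comment> \<open>keeps \<open>{1..n}\<close> from being rewritten to \<open>{Suc 0..n}\<close>\<close>

text \<open>Equal factors are collected: the value \<open>h\<close> of the key \<open>k\<close>
  contributes \<open>F h\<close> once for each element of its fibre, and a value that is never taken
  has exponent 0 and contributes 1. Below, the keys are scores or pairs of scores and the fibre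
  sizes are the counts in the exponents.\<close>

lemma prod_eq_prod_power_card:
  fixes F :: "'b \<Rightarrow> 'c::comm_monoid_mult"
  assumes "finite A" "finite B" "k ` A \<subseteq> B"
  shows "(\<Prod>j\<in>A. F (k j)) = (\<Prod>h\<in>B. F h ^ card {j\<in>A. k j = h})"
proof -
  have "(\<Prod>j\<in>A. F (k j)) = (\<Prod>h\<in>B. \<Prod>j\<in>{j\<in>A. k j = h}. F (k j))"
    by (rule prod.group[OF assms, symmetric])
  also have "\<dots> = (\<Prod>h\<in>B. F h ^ card {j\<in>A. k j = h})"
    by (intro prod.cong refl) simp
  finally show ?thesis .
qed

section \<open>The model at one feasible pair of parameters\<close>

locale feasible_score_model = score_model N E nC c nR r \<Theta> ph \<Gamma> pl M X Y
  for N :: nat and E :: "(nat \<times> nat) set"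
    and nC :: nat and c :: "nat \<Rightarrow> 's"
    and nR :: nat and r :: "nat \<Rightarrow> 'r"
    and \<Theta> :: "'t::topological_space set" and ph :: "nat \<Rightarrow> nat \<Rightarrow> nat \<Rightarrow> 't \<Rightarrow> real"
    and \<Gamma> :: "'g::topological_space set" and pl :: "nat \<Rightarrow> 'g \<Rightarrow> real"
    and M :: "'t \<Rightarrow> 'g \<Rightarrow> 'w measure"
    and X :: "nat \<Rightarrow> 'w \<Rightarrow> 's" and Y :: "nat \<times> nat \<Rightarrow> 'w \<Rightarrow> 'r" +
  fixes \<theta> :: 't and \<gamma> :: 'g
  assumes theta: "\<theta> \<in> feasible_Theta nC nR \<Theta> ph"
    and gamma: "\<gamma> \<in> feasible_Gamma nC \<Gamma> pl"
begin

sublocale P: prob_space "M \<theta> \<gamma>"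
  by (rule prob[OF theta gamma])

lemma finite_E [simp]: "finite E"
  using edges by (rule finite_subset) simp

lemma edge_nodes: "(a, b) \<in> E \<Longrightarrow> a \<in> {1..N} \<and> b \<in> {1..N}"
  using edges by auto

lemma no_loop [simp]: "(a, a) \<notin> E"
  using no_loops by (auto simp: irrefl_def)

lemma sum_pl: "(\<Sum>l=1..nC. pl l \<gamma>) = 1"
  and pl_nonneg: "l \<in> {1..nC} \<Longrightarrow> 0 \<le> pl l \<gamma>"
  using gamma by (auto simp: feasible_Gamma_def)

lemma sum_ph: "l \<in> {1..nC} \<Longrightarrow> m \<in> {1..nC} \<Longrightarrow> (\<Sum>h=1..nR. ph h l m \<theta>) = 1"
  using theta by (auto simp: feasible_Theta_def)

lemma state_range:
  "\<omega> \<in> space (M \<theta> \<gamma>) \<Longrightarrow> j \<in> {1..N} \<Longrightarrow> X j \<omega> \<in> c ` {1..nC}"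
  using measurable_space[OF rv_X[OF theta gamma]] by fastforce

lemma score_range:
  "\<omega> \<in> space (M \<theta> \<gamma>) \<Longrightarrow> e \<in> E \<Longrightarrow> Y e \<omega> \<in> r ` {1..nR}"
  using measurable_space[OF rv_Y[OF theta gamma]] by fastforce

section \<open>Measurability of state and score events\<close>

text \<open>An arbitrary \<open>A\<close> reduces to a subset of the state range: \<open>X j\<close>
  never leaves that range, so intersecting with it keeps the preimage.\<close>

lemma state_sets:
  assumes "j \<in> {1..N}"
  shows "{\<omega> \<in> space (M \<theta> \<gamma>). X j \<omega> \<in> A} \<in> sets (M \<theta> \<gamma>)"
proof -
  have "X j -` (A \<inter> c ` {1..nC}) \<inter> space (M \<theta> \<gamma>) \<in> sets (M \<theta> \<gamma>)"
    by (rule measurable_sets[OF rv_X[OF theta gamma assms]]) simp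
  moreover have "X j -` (A \<inter> c ` {1..nC}) \<inter> space (M \<theta> \<gamma>)
      = {\<omega> \<in> space (M \<theta> \<gamma>). X j \<omega> \<in> A}"
    using state_range[OF _ assms] by blast
  ultimately show ?thesis by simp
qed

lemma score_sets:
  assumes "e \<in> E"
  shows "{\<omega> \<in> space (M \<theta> \<gamma>). Y e \<omega> \<in> A} \<in> sets (M \<theta> \<gamma>)"
proof -
  have "Y e -` (A \<inter> r ` {1..nR}) \<inter> space (M \<theta> \<gamma>) \<in> sets (M \<theta> \<gamma>)"
    by (rule measurable_sets[OF rv_Y[OF theta gamma assms]]) simp
  moreover have "Y e -` (A \<inter> r ` {1..nR}) \<inter> space (M \<theta> \<gamma>)
      = {\<omega> \<in> space (M \<theta> \<gamma>). Y e \<omega> \<in> A}"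
    using score_range[OF _ assms] by blast
  ultimately show ?thesis by simp
qed

text \<open>With a set of values per variable, one statement covers both the fully specified
  profiles and the events where some variables are left free.\<close>

lemma box_sets:
  "{\<omega> \<in> space (M \<theta> \<gamma>). (\<forall>e\<in>E. Y e \<omega> \<in> B e) \<and> (\<forall>j\<in>{1..N}. X j \<omega> \<in> A j)}
    \<in> sets (M \<theta> \<gamma>)"
  by (intro sets.sets_Collect_conj sets.sets_Collect_finite_All' sets.sets_Collect_finite_All
      state_sets score_sets finite_E finite_atLeastAtMost)

section \<open>The joint law as a function of index profiles\<close>

text \<open>Profiles hold indices rather than values because \<open>ph\<close> and \<open>pl\<close>
  are indexed by numbers; injectivity of \<open>c\<close> and \<open>r\<close> makes the two views
  equivalent.\<close>

definition joint :: "(nat \<times> nat \<Rightarrow> nat) \<Rightarrow> (nat \<Rightarrow> nat) \<Rightarrow> real" where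
  "joint z x =
    \<P>(\<omega> in M \<theta> \<gamma>. (\<forall>e\<in>E. Y e \<omega> = r (z e)) \<and> (\<forall>j\<in>{1..N}. X j \<omega> = c (x j)))"

text \<open>Built from \<open>ph\<close> and not from conditional probabilities, so that it sums to
  1 over the scores even at profiles where a conditioning event is null.\<close>

definition lik :: "(nat \<times> nat \<Rightarrow> nat) \<Rightarrow> (nat \<Rightarrow> nat) \<Rightarrow> real" where
  "lik z x = (\<Prod>e\<in>E. ph (z e) (x (fst e)) (x (snd e)) \<theta>)"

definition prior :: "(nat \<Rightarrow> nat) \<Rightarrow> real" where
  "prior x = (\<Prod>j=1..N. pl (x j) \<gamma>)"

text \<open>These are the profiles at which \<open>score_law\<close> applies to every edge.\<close>

definition compat :: "(nat \<Rightarrow> nat) \<Rightarrow> bool" where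
  "compat x \<longleftrightarrow> (\<forall>(a, b)\<in>E. \<P>(\<omega> in M \<theta> \<gamma>. X a \<omega> = c (x a) \<and> X b \<omega> = c (x b)) > 0)"

text \<open>Finite additivity: every outcome in the box realizes exactly one pair of index profiles
  drawn from \<open>T\<close> and \<open>S\<close>.\<close>

lemma prob_box:
  assumes S: "\<And>e. e \<in> E \<Longrightarrow> S e \<subseteq> {1..nR}" and T: "\<And>j. j \<in> {1..N} \<Longrightarrow> T j \<subseteq> {1..nC}"
  shows "\<P>(\<omega> in M \<theta> \<gamma>. (\<forall>e\<in>E. Y e \<omega> \<in> r ` S e) \<and> (\<forall>j\<in>{1..N}. X j \<omega> \<in> c ` T j))
    = (\<Sum>x\<in>PiE {1..N} T. \<Sum>z\<in>PiE E S. joint z x)"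
proof -
  have fin: "finite (PiE {1..N} T)" "finite (PiE E S)"
    using finite_subset[OF S finite_atLeastAtMost] finite_subset[OF T finite_atLeastAtMost]
    by (auto intro!: finite_PiE)
  have uniq: "\<exists>!p\<in>PiE {1..N} T \<times> PiE E S.
      (\<forall>e\<in>E. Y e \<omega> = r (snd p e)) \<and> (\<forall>j\<in>{1..N}. X j \<omega> = c (fst p j))"
    if YS: "\<forall>e\<in>E. Y e \<omega> \<in> r ` S e" and XT: "\<forall>j\<in>{1..N}. X j \<omega> \<in> c ` T j" for \<omega>
  proof (rule ex_ex1I)
    obtain z where z: "\<forall>e\<in>E. z e \<in> S e \<and> Y e \<omega> = r (z e)"
      using bchoice[of E "\<lambda>e h. h \<in> S e \<and> Y e \<omega> = r h"] YS by blast
    obtain x where x: "\<forall>j\<in>{1..N}. x j \<in> T j \<and> X j \<omega> = c (x j)"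
      using bchoice[of "{1..N}" "\<lambda>j l. l \<in> T j \<and> X j \<omega> = c l"] XT by blast
    show "\<exists>p. p \<in> PiE {1..N} T \<times> PiE E S \<and>
        (\<forall>e\<in>E. Y e \<omega> = r (snd p e)) \<and> (\<forall>j\<in>{1..N}. X j \<omega> = c (fst p j))"
      \<comment> \<open>Restricting the chosen functions makes them extensional, as membership in
        \<open>PiE\<close> requires.\<close>
      by (rule exI[of _ "(restrict x {1..N}, restrict z E)"]) (use x z in auto)
  next
    fix p q
    assume p: "p \<in> PiE {1..N} T \<times> PiE E S \<and>
        (\<forall>e\<in>E. Y e \<omega> = r (snd p e)) \<and> (\<forall>j\<in>{1..N}. X j \<omega> = c (fst p j))"
      and q: "q \<in> PiE {1..N} T \<times> PiE E S \<and>
        (\<forall>e\<in>E. Y e \<omega> = r (snd q e)) \<and> (\<forall>j\<in>{1..N}. X j \<omega> = c (fst q j))"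
    have "fst p = fst q"
    proof (rule PiE_ext)
      show "fst p \<in> PiE {1..N} T" "fst q \<in> PiE {1..N} T" using p q by auto
      fix j assume j: "j \<in> {1..N}"
      have "c (fst p j) = c (fst q j)" using p q j by metis
      moreover have "fst p j \<in> T j" "fst q j \<in> T j" using p q j by (auto simp: mem_Times_iff)
      ultimately show "fst p j = fst q j" using T[OF j] states by (auto dest: inj_onD)
    qed
    moreover have "snd p = snd q"
    proof (rule PiE_ext)
      show "snd p \<in> PiE E S" "snd q \<in> PiE E S" using p q by auto
      fix e assume e: "e \<in> E"
      have "r (snd p e) = r (snd q e)" using p q e by metis
      moreover have "snd p e \<in> S e" "snd q e \<in> S e" using p q e by (auto simp: mem_Times_iff)
      ultimately show "snd p e = snd q e" using S[OF e] scores by (auto dest: inj_onD)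
    qed
    ultimately show "p = q" by (simp add: prod_eq_iff)
  qed
  have "\<P>(\<omega> in M \<theta> \<gamma>. (\<forall>e\<in>E. Y e \<omega> \<in> r ` S e) \<and> (\<forall>j\<in>{1..N}. X j \<omega> \<in> c ` T j))
    = (\<Sum>p\<in>PiE {1..N} T \<times> PiE E S. joint (snd p) (fst p))"
    unfolding joint_def
  proof (rule P.prob_sum)
    show "finite (PiE {1..N} T \<times> PiE E S)" using fin by simp
    show "{\<omega> \<in> space (M \<theta> \<gamma>). (\<forall>e\<in>E. Y e \<omega> = r (snd p e)) \<and>
        (\<forall>j\<in>{1..N}. X j \<omega> = c (fst p j))} \<in> P.events" for p
      using box_sets[of "\<lambda>e. {r (snd p e)}" "\<lambda>j. {c (fst p j)}"] by simp
    show "{\<omega> \<in> space (M \<theta> \<gamma>). (\<forall>e\<in>E. Y e \<omega> \<in> r ` S e) \<and>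
        (\<forall>j\<in>{1..N}. X j \<omega> \<in> c ` T j)} \<in> P.events"
      by (rule box_sets)
    show "AE \<omega> in M \<theta> \<gamma>.
      (\<forall>p\<in>PiE {1..N} T \<times> PiE E S.
        (\<forall>e\<in>E. Y e \<omega> = r (snd p e)) \<and> (\<forall>j\<in>{1..N}. X j \<omega> = c (fst p j)) \<longrightarrow>
        (\<forall>e\<in>E. Y e \<omega> \<in> r ` S e) \<and> (\<forall>j\<in>{1..N}. X j \<omega> \<in> c ` T j)) \<and>
      ((\<forall>e\<in>E. Y e \<omega> \<in> r ` S e) \<and> (\<forall>j\<in>{1..N}. X j \<omega> \<in> c ` T j) \<longrightarrow>
        (\<exists>!p\<in>PiE {1..N} T \<times> PiE E S.
          (\<forall>e\<in>E. Y e \<omega> = r (snd p e)) \<and> (\<forall>j\<in>{1..N}. X j \<omega> = c (fst p j))))"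
    proof (rule AE_I2, rule conjI, intro ballI impI)
      fix p \<omega>
      assume "p \<in> PiE {1..N} T \<times> PiE E S"
        and "(\<forall>e\<in>E. Y e \<omega> = r (snd p e)) \<and> (\<forall>j\<in>{1..N}. X j \<omega> = c (fst p j))"
      then show "(\<forall>e\<in>E. Y e \<omega> \<in> r ` S e) \<and> (\<forall>j\<in>{1..N}. X j \<omega> \<in> c ` T j)"
        by (metis PiE_mem image_eqI mem_Times_iff)
    next
      fix \<omega>
      show "(\<forall>e\<in>E. Y e \<omega> \<in> r ` S e) \<and> (\<forall>j\<in>{1..N}. X j \<omega> \<in> c ` T j) \<longrightarrow>
        (\<exists>!p\<in>PiE {1..N} T \<times> PiE E S.
          (\<forall>e\<in>E. Y e \<omega> = r (snd p e)) \<and> (\<forall>j\<in>{1..N}. X j \<omega> = c (fst p j)))"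
        by (intro impI uniq) (rule conjunct1 conjunct2, assumption)+
    qed
  qed
  also have "\<dots> = (\<Sum>x\<in>PiE {1..N} T. \<Sum>z\<in>PiE E S. joint z x)"
    using fin by (simp add: sum.cartesian_product split_beta)
  finally show ?thesis .
qed

text \<open>If all conditioning events have positive probability, the three laws combine to the
  product. Otherwise the profile event lies inside a null event.\<close>

lemma joint_compat:
  assumes z: "z \<in> E \<rightarrow> {1..nR}" and x: "x \<in> {1..N} \<rightarrow> {1..nC}"
  shows "joint z x = (if compat x then lik z x * prior x else 0)"
proof (cases "compat x")
  case True
  have "joint z x = (\<Prod>(a, b)\<in>E. \<P>(\<omega> in M \<theta> \<gamma>. Y (a, b) \<omega> = r (z (a, b))
                            \<bar> X a \<omega> = c (x a) \<and> X b \<omega> = c (x b))) *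
            (\<Prod>j=1..N. \<P>(\<omega> in M \<theta> \<gamma>. X j \<omega> = c (x j)))"
    unfolding joint_def by (rule joint_law[OF theta gamma]) (use x z in auto)
  also have "(\<Prod>(a, b)\<in>E. \<P>(\<omega> in M \<theta> \<gamma>. Y (a, b) \<omega> = r (z (a, b))
                            \<bar> X a \<omega> = c (x a) \<and> X b \<omega> = c (x b))) = lik z x"
    unfolding lik_def
  proof (intro prod.cong refl, clarsimp)
    fix a b assume e: "(a, b) \<in> E"
    have "z (a, b) \<in> {1..nR}" "x a \<in> {1..nC}" "x b \<in> {1..nC}"
      using x z e edge_nodes[OF e] by auto
    then show "\<P>(\<omega> in M \<theta> \<gamma>. Y (a, b) \<omega> = r (z (a, b)) \<bar> X a \<omega> = c (x a) \<and> X b \<omega> = c (x b))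
        = ph (z (a, b)) (x a) (x b) \<theta>"
      using True e by (intro score_law[OF theta gamma e]) (auto simp: compat_def)
  qed
  also have "(\<Prod>j=1..N. \<P>(\<omega> in M \<theta> \<gamma>. X j \<omega> = c (x j))) = prior x"
    unfolding prior_def using x by (intro prod.cong refl state_law[OF theta gamma]) auto
  finally show ?thesis using True by simp
next
  case False
  then obtain a b where e: "(a, b) \<in> E"
    and n: "\<not> \<P>(\<omega> in M \<theta> \<gamma>. X a \<omega> = c (x a) \<and> X b \<omega> = c (x b)) > 0"
    by (auto simp: compat_def)
  note ab = edge_nodes[OF e]
  \<comment> \<open>Monotonicity suffices here: fixing the whole profile fixes in particular the
    states of \<open>a\<close> and \<open>b\<close>, and that event is null by
    \<open>n\<close>.\<close>
  have "joint z x \<le> \<P>(\<omega> in M \<theta> \<gamma>. X a \<omega> = c (x a) \<and> X b \<omega> = c (x b))"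
    unfolding joint_def
  proof (rule P.finite_measure_mono)
    show "{\<omega> \<in> space (M \<theta> \<gamma>). X a \<omega> = c (x a) \<and> X b \<omega> = c (x b)} \<in> P.events"
      using state_sets[of a "{c (x a)}"] state_sets[of b "{c (x b)}"] ab
      by (intro sets.sets_Collect_conj) auto
  qed (use ab in auto)
  then show ?thesis
    using False n by (simp add: joint_def not_less measure_le_0_iff)
qed

section \<open>Total mass and the full product form\<close>

text \<open>Distributivity over the edges. \<open>S\<close> varies with the edge because later the
  edges at one agent carry a single observed score while all others are summed over the whole score
  range.\<close>

lemma sum_lik:
  assumes "\<And>e. e \<in> E \<Longrightarrow> S e \<subseteq> {1..nR}"
  shows "(\<Sum>z\<in>PiE E S. lik z x) = (\<Prod>e\<in>E. \<Sum>h\<in>S e. ph h (x (fst e)) (x (snd e)) \<theta>)"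
  unfolding lik_def using assms
  by (subst prod_sum_PiE) (auto intro: finite_subset)

lemma sum_lik_all:
  assumes "x \<in> {1..N} \<rightarrow> {1..nC}"
  shows "(\<Sum>z\<in>E \<rightarrow>\<^sub>E {1..nR}. lik z x) = 1"
proof -
  have "(\<Sum>h=1..nR. ph h (x (fst e)) (x (snd e)) \<theta>) = 1" if "e \<in> E" for e
    using that edge_nodes[of "fst e" "snd e"] assms by (intro sum_ph) auto
  then show ?thesis by (simp add: sum_lik)
qed

lemma sum_prior: "(\<Sum>x\<in>{1..N} \<rightarrow>\<^sub>E {1..nC}. prior x) = 1"
proof -
  have "(\<Sum>x\<in>{1..N} \<rightarrow>\<^sub>E {1..nC}. prior x) = (\<Prod>j=1..N. \<Sum>l=1..nC. pl l \<gamma>)"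
    unfolding prior_def by (subst prod_sum_PiE) auto
  then show ?thesis by (simp add: sum_pl)
qed

lemma prior_nonneg: "x \<in> {1..N} \<rightarrow> {1..nC} \<Longrightarrow> 0 \<le> prior x"
  unfolding prior_def by (intro prod_nonneg pl_nonneg) auto

text \<open>Positive priors at both ends of an edge do not alone make the joint state event
  positive, as independence is not assumed. Total mass decides: the priors of the
  \<open>compat\<close> profiles already sum to 1, and so do the priors of all profiles, so the
  nonnegative remainder vanishes term by term.\<close>

lemma prior_zero_if_not_compat:
  assumes x: "x \<in> {1..N} \<rightarrow>\<^sub>E {1..nC}" and "\<not> compat x"
  shows "prior x = 0"
proof -
  let ?A = "{1..N} \<rightarrow>\<^sub>E {1..nC}"
  have fin: "finite ?A" by (intro finite_PiE) auto
  \<comment> \<open>All variables stay in their ranges, so this event is the whole space.\<close>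
  have "1 = \<P>(\<omega> in M \<theta> \<gamma>. (\<forall>e\<in>E. Y e \<omega> \<in> r ` {1..nR}) \<and> (\<forall>j\<in>{1..N}. X j \<omega> \<in> c ` {1..nC}))"
    using state_range score_range P.prob_space
    by (intro sym[OF trans[OF arg_cong[where f = "measure (M \<theta> \<gamma>)"]]]) auto
  also have "\<dots> = (\<Sum>x\<in>?A. \<Sum>z\<in>E \<rightarrow>\<^sub>E {1..nR}. joint z x)"
    by (rule prob_box) auto
  also have "\<dots> = (\<Sum>x\<in>?A. if compat x then prior x else 0)"
  proof (rule sum.cong[OF refl])
    fix x assume x: "x \<in> ?A"
    \<comment> \<open>Neither \<open>compat x\<close> nor \<open>prior x\<close> depends on the
      scores, so only \<open>lik\<close> is summed, and it sums to 1.\<close>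
    have "(\<Sum>z\<in>E \<rightarrow>\<^sub>E {1..nR}. joint z x)
      = (\<Sum>z\<in>E \<rightarrow>\<^sub>E {1..nR}. lik z x * (if compat x then prior x else 0))"
      using x by (intro sum.cong refl) (auto simp: joint_compat PiE_iff)
    also have "\<dots> = (\<Sum>z\<in>E \<rightarrow>\<^sub>E {1..nR}. lik z x) * (if compat x then prior x else 0)"
      by (rule sum_distrib_right[symmetric])
    also have "(\<Sum>z\<in>E \<rightarrow>\<^sub>E {1..nR}. lik z x) = 1"
      using x by (intro sum_lik_all) auto
    finally show "(\<Sum>z\<in>E \<rightarrow>\<^sub>E {1..nR}. joint z x) = (if compat x then prior x else 0)" by simp
  qed
  finally have "(\<Sum>x\<in>?A. prior x - (if compat x then prior x else 0)) = 0"
    by (simp add: sum_subtractf sum_prior)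
  \<comment> \<open>The difference is 0 at a \<open>compat\<close> profile and
    \<open>prior x\<close> at any other.\<close>
  moreover have "0 \<le> prior x - (if compat x then prior x else 0)" if "x \<in> ?A" for x
    using that prior_nonneg[of x] by auto
  ultimately have "prior x - (if compat x then prior x else 0) = 0"
    using sum_nonneg_eq_0_iff[OF fin, of "\<lambda>x. prior x - (if compat x then prior x else 0)"] x
    by blast
  then show ?thesis using assms by simp
qed

text \<open>The case split of \<open>joint_compat\<close> disappears because the product also
  vanishes where \<open>compat\<close> fails.\<close>

lemma joint_eq:
  assumes "z \<in> E \<rightarrow> {1..nR}" and "x \<in> {1..N} \<rightarrow>\<^sub>E {1..nC}"
  shows "joint z x = lik z x * prior x"
proof -
  have "x \<in> {1..N} \<rightarrow> {1..nC}" using assms(2) by (simp add: PiE_def)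
  from joint_compat[OF assms(1) this] show ?thesis
    using prior_zero_if_not_compat[OF assms(2)] by simp
qed

section \<open>Joint probability of one agent's state and its local scores\<close>

lemma finite_local_edges [simp]: "finite (local_edges E i)"
  by (rule finite_subset[of _ E]) (auto simp: local_edges_def)

text \<open>Each local edge is assigned to its endpoint other than \<open>i\<close>, which exists
  because there are no loops. An agent \<open>j\<close> then owns at most two edges, one in each
  direction.\<close>

lemma prod_local_edges:
  assumes "i \<in> {1..N}"
  shows "(\<Prod>e\<in>local_edges E i. f e) =
    (\<Prod>j\<in>{1..N} - {i}. (if (i, j) \<in> E then f (i, j) else 1) * (if (j, i) \<in> E then f (j, i) else 1))"
proof -
  let ?J = "{1..N} - {i}"
  have L: "local_edges E i = Pair i ` {j\<in>?J. (i, j) \<in> E} \<union> (\<lambda>j. (j, i)) ` {j\<in>?J. (j, i) \<in> E}"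
  proof -
    have "j \<in> ?J" if "(i, j) \<in> E \<or> (j, i) \<in> E" for j
      using that edge_nodes[of i j] edge_nodes[of j i] no_loop[of i] by blast
    then have "{j\<in>?J. (i, j) \<in> E} = {j. (i, j) \<in> E}" "{j\<in>?J. (j, i) \<in> E} = {j. (j, i) \<in> E}"
      by blast+
    then show ?thesis by (auto simp: local_edges_def)
  qed
  have "(\<Prod>e\<in>local_edges E i. f e) =
     (\<Prod>e\<in>Pair i ` {j\<in>?J. (i, j) \<in> E}. f e) * (\<Prod>e\<in>(\<lambda>j. (j, i)) ` {j\<in>?J. (j, i) \<in> E}. f e)"
    \<comment> \<open>An edge in both images would have \<open>i\<close> at both ends, but
      \<open>i\<close> is not in \<open>?J\<close>.\<close>
    unfolding L by (rule prod.union_disjoint) auto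
  also have "\<dots> = (\<Prod>j\<in>{j\<in>?J. (i, j) \<in> E}. f (i, j)) * (\<Prod>j\<in>{j\<in>?J. (j, i) \<in> E}. f (j, i))"
    by (simp add: prod.reindex inj_on_def)
  also have "\<dots> = (\<Prod>j\<in>?J. if (i, j) \<in> E then f (i, j) else 1) *
      (\<Prod>j\<in>?J. if (j, i) \<in> E then f (j, i) else 1)"
    by (simp only: prod.inter_filter[OF finite_Diff[OF finite_atLeastAtMost]])
  finally show ?thesis by (simp add: prod.distrib)
qed

text \<open>The event is a box, so its probability is a sum of values of \<open>joint\<close>.
  Scores away from \<open>i\<close> sum out to 1. Once the state of \<open>i\<close> is fixed, every
  remaining factor involves the state of a single other agent, and the sum of products becomes a
  product of sums.\<close>

lemma prob_state_local_scores:
  assumes i: "i \<in> {1..N}" and l: "l \<in> {1..nC}"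
    and z: "\<And>e. e \<in> local_edges E i \<Longrightarrow> z e \<in> {1..nR} \<and> y e = r (z e)"
    and y: "y \<in> extensional (local_edges E i)"
  shows "\<P>(\<omega> in M \<theta> \<gamma>. X i \<omega> = c l \<and> local_scores E i Y \<omega> = y) =
    pl l \<gamma> * (\<Prod>j\<in>{1..N} - {i}. \<Sum>m=1..nC.
      (if (i, j) \<in> E then ph (z (i, j)) l m \<theta> else 1) *
      (if (j, i) \<in> E then ph (z (j, i)) m l \<theta> else 1) * pl m \<gamma>)"
proof -
  let ?L = "local_edges E i"
  \<comment> \<open>\<open>S\<close> pins the observed scores and \<open>T\<close> pins the state of
    \<open>i\<close>; everything else is free.\<close>
  define S where "S e = (if e \<in> ?L then {z e} else {1..nR})" for e
  define T where "T j = (if j = i then {l} else {1..nC})" for j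
  have S: "S e \<subseteq> {1..nR}" for e using z by (auto simp: S_def)
  have T: "T j \<subseteq> {1..nC}" for j using l by (auto simp: T_def)
  have LE: "?L \<subseteq> E" by (auto simp: local_edges_def)
  have ev: "(X i \<omega> = c l \<and> local_scores E i Y \<omega> = y) \<longleftrightarrow>
      (\<forall>e\<in>E. Y e \<omega> \<in> r ` S e) \<and> (\<forall>j\<in>{1..N}. X j \<omega> \<in> c ` T j)"
    if "\<omega> \<in> space (M \<theta> \<gamma>)" for \<omega>
  proof -
    \<comment> \<open>Both functions are extensional on the local edges, so equality is agreement
      there. Free edges impose no condition, since scores stay in their range.\<close>
    have "local_scores E i Y \<omega> = y \<longleftrightarrow> (\<forall>e\<in>?L. Y e \<omega> = y e)"
      using y by (auto simp: local_scores_def fun_eq_iff restrict_def extensional_def)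
    also have "\<dots> \<longleftrightarrow> (\<forall>e\<in>E. Y e \<omega> \<in> r ` S e)"
      using z LE score_range[OF that] by (auto simp: S_def)
    finally have 1: "local_scores E i Y \<omega> = y \<longleftrightarrow> (\<forall>e\<in>E. Y e \<omega> \<in> r ` S e)" .
    have "X i \<omega> = c l \<longleftrightarrow> (\<forall>j\<in>{1..N}. X j \<omega> \<in> c ` T j)"
      using i state_range[OF that] by (auto simp: T_def)
    with 1 show ?thesis by blast
  qed
  define g where "g j m =
      (if (i, j) \<in> E then ph (z (i, j)) l m \<theta> else 1) *
      (if (j, i) \<in> E then ph (z (j, i)) m l \<theta> else 1) * pl m \<gamma>" for j m
  have "\<P>(\<omega> in M \<theta> \<gamma>. X i \<omega> = c l \<and> local_scores E i Y \<omega> = y)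
      = (\<Sum>x\<in>PiE {1..N} T. \<Sum>w\<in>PiE E S. joint w x)"
    using prob_box[of S T] S T ev by (simp cong: conj_cong)
  also have "\<dots> = (\<Sum>x\<in>PiE {1..N} T. \<Prod>j=1..N. if j = i then pl l \<gamma> else g j (x j))"
  proof (rule sum.cong[OF refl])
    fix x assume x: "x \<in> PiE {1..N} T"
    have xi: "x i = l" using PiE_mem[OF x i] by (simp add: T_def)
    have x': "x \<in> {1..N} \<rightarrow>\<^sub>E {1..nC}" using PiE_mono[of "{1..N}" T "\<lambda>_. {1..nC}"] x T by blast
    have "(\<Sum>w\<in>PiE E S. joint w x) = (\<Sum>w\<in>PiE E S. lik w x * prior x)"
    proof (rule sum.cong[OF refl])
      fix w assume "w \<in> PiE E S"
      then have "w \<in> E \<rightarrow> {1..nR}" using S by blast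
      then show "joint w x = lik w x * prior x" using x' by (rule joint_eq)
    qed
    also have "\<dots> = (\<Prod>e\<in>E. \<Sum>h\<in>S e. ph h (x (fst e)) (x (snd e)) \<theta>) * prior x"
      using S by (simp add: sum_distrib_right[symmetric] sum_lik)
    \<comment> \<open>On a local edge the inner sum has the single term \<open>z e\<close>; on any
      other edge it is a full conditional distribution and equals 1.\<close>
    also have "(\<Prod>e\<in>E. \<Sum>h\<in>S e. ph h (x (fst e)) (x (snd e)) \<theta>)
        = (\<Prod>e\<in>?L. ph (z e) (x (fst e)) (x (snd e)) \<theta>)"
    proof (rule prod.mono_neutral_cong_right[OF finite_E LE])
      show "\<forall>e\<in>E - ?L. (\<Sum>h\<in>S e. ph h (x (fst e)) (x (snd e)) \<theta>) = 1"
      proof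
        fix e assume e: "e \<in> E - ?L"
        then have "fst e \<in> {1..N}" "snd e \<in> {1..N}" using edge_nodes[of "fst e" "snd e"] by auto
        then have "x (fst e) \<in> {1..nC}" "x (snd e) \<in> {1..nC}" using x' by (blast dest: PiE_mem)+
        then show "(\<Sum>h\<in>S e. ph h (x (fst e)) (x (snd e)) \<theta>) = 1"
          using e sum_ph by (simp add: S_def)
      qed
    qed (simp add: S_def)
    also have "\<dots> = (\<Prod>j\<in>{1..N} - {i}.
        (if (i, j) \<in> E then ph (z (i, j)) l (x j) \<theta> else 1) *
        (if (j, i) \<in> E then ph (z (j, i)) (x j) l \<theta> else 1))"
      by (simp add: prod_local_edges[OF i] xi cong: if_cong)
    \<comment> \<open>The prior of \<open>i\<close> is split off, and the prior of each other agent
      is absorbed into its factor \<open>g\<close>.\<close>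
    also have "\<dots> * prior x = pl l \<gamma> * (\<Prod>j\<in>{1..N} - {i}. g j (x j))"
      unfolding prior_def prod.remove[OF finite_atLeastAtMost i] xi g_def prod.distrib
      by (simp add: mult_ac)
    also have "\<dots> = (\<Prod>j=1..N. if j = i then pl l \<gamma> else g j (x j))"
      unfolding prod.remove[OF finite_atLeastAtMost i] by simp
    finally show "(\<Sum>w\<in>PiE E S. joint w x) = (\<Prod>j=1..N. if j = i then pl l \<gamma> else g j (x j))" .
  qed
  \<comment> \<open>The factor at \<open>j\<close> depends on \<open>x\<close> only through
    \<open>x j\<close>, so sum and product may be exchanged; at \<open>i\<close> the sum has one
    term.\<close>
  also have "\<dots> = (\<Prod>j=1..N. \<Sum>m\<in>T j. if j = i then pl l \<gamma> else g j m)"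
    by (rule prod_sum_PiE[symmetric]) (auto simp: T_def)
  also have "\<dots> = pl l \<gamma> * (\<Prod>j\<in>{1..N} - {i}. \<Sum>m=1..nC. g j m)"
    unfolding prod.remove[OF finite_atLeastAtMost i] by (simp add: T_def)
  finally show ?thesis by (simp add: g_def)
qed

section \<open>Grouping the neighbours by observed scores\<close>

text \<open>The factor of \<open>j\<close> depends only on which edges join it to \<open>i\<close>
  and on the scores they carry. Splitting the agents by edge type and collecting equal factors
  yields the three products of powers; a zero exponent gives 1 for every base, including 0.\<close>

lemma prod_neighbours:
  assumes z: "\<And>e. e \<in> local_edges E i \<Longrightarrow> z e \<in> {1..nR} \<and> y e = r (z e)"
  shows "(\<Prod>j\<in>{1..N} - {i}. \<Sum>m=1..nC.
      (if (i, j) \<in> E then ph (z (i, j)) l m \<theta> else 1) *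
      (if (j, i) \<in> E then ph (z (j, i)) m l \<theta> else 1) * pl m \<gamma>) =
    (\<Prod>h=1..nR. \<Prod>k=1..nR.
      (\<Sum>m=1..nC. ph k m l \<theta> * ph h l m \<theta> * pl m \<gamma>) ^ count_both E r y i h k) *
    (\<Prod>h=1..nR. (\<Sum>m=1..nC. ph h m l \<theta> * pl m \<gamma>) ^ count_in E r y i h) *
    (\<Prod>h=1..nR. (\<Sum>m=1..nC. ph h l m \<theta> * pl m \<gamma>) ^ count_out E r y i h)"
    (is "_ = ?B * ?I * ?O")
proof -
  let ?J = "{1..N} - {i}"
  define G where "G j = (\<Sum>m=1..nC.
      (if (i, j) \<in> E then ph (z (i, j)) l m \<theta> else 1) *
      (if (j, i) \<in> E then ph (z (j, i)) m l \<theta> else 1) * pl m \<gamma>)" for j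
  have sub: "nbrs_both E i \<union> nbrs_in E i \<union> nbrs_out E i \<subseteq> ?J"
    by (auto simp: nbrs_both_def nbrs_in_def nbrs_out_def dest: edge_nodes)
  then have fin: "finite (nbrs_both E i)" "finite (nbrs_in E i)" "finite (nbrs_out E i)"
    by (auto intro: finite_subset[of _ ?J])
  \<comment> \<open>The counts speak of score values and the factors of indices; injectivity of
    \<open>r\<close> identifies the two.\<close>
  have req: "y e = r h \<longleftrightarrow> z e = h" if "e \<in> local_edges E i" "h \<in> {1..nR}" for e h
    using z[OF that(1)] that(2) scores by (auto dest: inj_onD)
  have "(\<Prod>j\<in>?J. G j) = (\<Prod>j\<in>nbrs_both E i \<union> nbrs_in E i \<union> nbrs_out E i. G j)"
  proof (rule prod.mono_neutral_right[OF _ sub])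
    \<comment> \<open>An agent not joined to \<open>i\<close> contributes only the sum of the
      priors, which is 1.\<close>
    show "\<forall>j\<in>?J - (nbrs_both E i \<union> nbrs_in E i \<union> nbrs_out E i). G j = 1"
    proof
      fix j assume "j \<in> ?J - (nbrs_both E i \<union> nbrs_in E i \<union> nbrs_out E i)"
      then have "(i, j) \<notin> E" "(j, i) \<notin> E"
        unfolding nbrs_both_def nbrs_in_def nbrs_out_def by blast+
      then show "G j = 1" by (simp add: G_def sum_pl)
    qed
  qed simp
  also have "\<dots> = (\<Prod>j\<in>nbrs_both E i. G j) * (\<Prod>j\<in>nbrs_in E i. G j) * (\<Prod>j\<in>nbrs_out E i. G j)"
  proof -
    have "(nbrs_both E i \<union> nbrs_in E i) \<inter> nbrs_out E i = {}" "nbrs_both E i \<inter> nbrs_in E i = {}"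
      by (auto simp: nbrs_both_def nbrs_in_def nbrs_out_def)
    then show ?thesis using fin by (simp only: prod.union_disjoint finite_Un simp_thms)
  qed
  finally have split: "(\<Prod>j\<in>?J. G j) =
      (\<Prod>j\<in>nbrs_both E i. G j) * (\<Prod>j\<in>nbrs_in E i. G j) * (\<Prod>j\<in>nbrs_out E i. G j)" .
  have both: "(\<Prod>j\<in>nbrs_both E i. G j) = ?B"
  proof -
    \<comment> \<open>The key is a pair: first the score that \<open>i\<close> gives, then the score
      that it receives, the order used by \<open>count_both\<close>. Both scores share one sum over
      \<open>m\<close> because they depend on the same state of \<open>j\<close>.\<close>
    define F where "F p = (\<Sum>m=1..nC. ph (snd p) m l \<theta> * ph (fst p) l m \<theta> * pl m \<gamma>)" for p
    have "(\<Prod>j\<in>nbrs_both E i. G j) = (\<Prod>j\<in>nbrs_both E i. F (z (i, j), z (j, i)))"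
      by (intro prod.cong refl) (auto simp: F_def G_def nbrs_both_def mult_ac)
    also have "\<dots> = (\<Prod>p\<in>{1..nR} \<times> {1..nR}.
        F p ^ card {j\<in>nbrs_both E i. (z (i, j), z (j, i)) = p})"
      using fin z
      by (intro prod_eq_prod_power_card) (auto simp: nbrs_both_def local_edges_def)
    also have "\<dots> = (\<Prod>(h, k)\<in>{1..nR} \<times> {1..nR}. F (h, k) ^ count_both E r y i h k)"
      unfolding split_beta count_both_def
      by (intro prod.cong refl arg_cong2[where f = power] arg_cong[where f = card])
        (auto simp: nbrs_both_def local_edges_def req)
    finally show ?thesis by (simp add: F_def prod.cartesian_product)
  qed
  have in_only: "(\<Prod>j\<in>nbrs_in E i. G j) = ?I"
  proof -
    define F where "F h = (\<Sum>m=1..nC. ph h m l \<theta> * pl m \<gamma>)" for h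
    have "(\<Prod>j\<in>nbrs_in E i. G j) = (\<Prod>j\<in>nbrs_in E i. F (z (j, i)))"
      by (intro prod.cong refl) (auto simp: F_def G_def nbrs_in_def)
    also have "\<dots> = (\<Prod>h=1..nR. F h ^ card {j\<in>nbrs_in E i. z (j, i) = h})"
      using fin z by (intro prod_eq_prod_power_card) (auto simp: nbrs_in_def local_edges_def)
    also have "\<dots> = (\<Prod>h=1..nR. F h ^ count_in E r y i h)"
      unfolding count_in_def
      by (intro prod.cong refl arg_cong2[where f = power] arg_cong[where f = card])
        (auto simp: nbrs_in_def local_edges_def req)
    finally show ?thesis by (simp add: F_def)
  qed
  have out_only: "(\<Prod>j\<in>nbrs_out E i. G j) = ?O"
  proof -
    define F where "F h = (\<Sum>m=1..nC. ph h l m \<theta> * pl m \<gamma>)" for h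
    have "(\<Prod>j\<in>nbrs_out E i. G j) = (\<Prod>j\<in>nbrs_out E i. F (z (i, j)))"
      by (intro prod.cong refl) (auto simp: F_def G_def nbrs_out_def)
    also have "\<dots> = (\<Prod>h=1..nR. F h ^ card {j\<in>nbrs_out E i. z (i, j) = h})"
      using fin z by (intro prod_eq_prod_power_card) (auto simp: nbrs_out_def local_edges_def)
    also have "\<dots> = (\<Prod>h=1..nR. F h ^ count_out E r y i h)"
      unfolding count_out_def
      by (intro prod.cong refl arg_cong2[where f = power] arg_cong[where f = card])
        (auto simp: nbrs_out_def local_edges_def req)
    finally show ?thesis by (simp add: F_def)
  qed
  show ?thesis using split unfolding both in_only out_only by (simp only: G_def)
qed

section \<open>Total probability over the agent's state\<close>

lemma local_scores_sets:
  assumes "y \<in> extensional (local_edges E i)"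
  shows "{\<omega> \<in> space (M \<theta> \<gamma>). local_scores E i Y \<omega> = y} \<in> sets (M \<theta> \<gamma>)"
proof -
  have "{\<omega> \<in> space (M \<theta> \<gamma>). local_scores E i Y \<omega> = y}
      = {\<omega> \<in> space (M \<theta> \<gamma>). \<forall>e\<in>local_edges E i. Y e \<omega> \<in> {y e}}"
    using assms by (auto simp: local_scores_def fun_eq_iff restrict_def extensional_def)
  also have "\<dots> \<in> sets (M \<theta> \<gamma>)"
    by (intro sets.sets_Collect_finite_All' sets.sets_Collect_finite_All score_sets
        finite_local_edges) (auto simp: local_edges_def)
  finally show ?thesis .
qed

text \<open>On each outcome the state of \<open>i\<close> has an index, by
  \<open>state_range\<close>, and only one, by injectivity of \<open>c\<close>. The events on the
  right thus partition the event on the left.\<close>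

lemma prob_local_scores:
  assumes i: "i \<in> {1..N}" and y: "y \<in> extensional (local_edges E i)"
  shows "\<P>(\<omega> in M \<theta> \<gamma>. local_scores E i Y \<omega> = y) =
    (\<Sum>l=1..nC. \<P>(\<omega> in M \<theta> \<gamma>. X i \<omega> = c l \<and> local_scores E i Y \<omega> = y))"
proof (rule P.prob_sum)
  note D = local_scores_sets[OF y]
  show "{\<omega> \<in> space (M \<theta> \<gamma>). local_scores E i Y \<omega> = y} \<in> P.events" by (rule D)
  show "{\<omega> \<in> space (M \<theta> \<gamma>). X i \<omega> = c l \<and> local_scores E i Y \<omega> = y} \<in> P.events" for l
    using state_sets[OF i, of "{c l}"] D by (intro sets.sets_Collect_conj) auto
  show "AE \<omega> in M \<theta> \<gamma>.
    (\<forall>l\<in>{1..nC}. X i \<omega> = c l \<and> local_scores E i Y \<omega> = y \<longrightarrow> local_scores E i Y \<omega> = y) \<and>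
    (local_scores E i Y \<omega> = y \<longrightarrow> (\<exists>!l\<in>{1..nC}. X i \<omega> = c l \<and> local_scores E i Y \<omega> = y))"
  proof (intro AE_I2 conjI impI)
    fix \<omega> assume w: "\<omega> \<in> space (M \<theta> \<gamma>)" "local_scores E i Y \<omega> = y"
    obtain l where "l \<in> {1..nC}" "X i \<omega> = c l" using state_range[OF w(1) i] by auto
    then show "\<exists>!l\<in>{1..nC}. X i \<omega> = c l \<and> local_scores E i Y \<omega> = y"
      using w states by (intro ex1I[of _ l]) (auto dest: inj_onD)
  qed auto
qed simp

end

section \<open>The posterior by Bayes' formula\<close>

theorem mainTheorem1:
  fixes N nC nR i :: nat
    and E :: "(nat \<times> nat) set"
    and c :: "nat \<Rightarrow> 's" and r :: "nat \<Rightarrow> 'r"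
    and \<Theta> :: "'t::topological_space set" and ph :: "nat \<Rightarrow> nat \<Rightarrow> nat \<Rightarrow> 't \<Rightarrow> real"
    and \<Gamma> :: "'g::topological_space set" and pl :: "nat \<Rightarrow> 'g \<Rightarrow> real"
    and M :: "'t \<Rightarrow> 'g \<Rightarrow> 'w measure"
    and X :: "nat \<Rightarrow> 'w \<Rightarrow> 's" and Y :: "nat \<times> nat \<Rightarrow> 'w \<Rightarrow> 'r"
    and \<theta> :: 't and \<gamma> :: 'g and y :: "nat \<times> nat \<Rightarrow> 'r"
    and u v pi_both pi_in pi_out :: "nat \<Rightarrow> real" and Z :: real
  assumes model: "score_model N E nC c nR r \<Theta> ph \<Gamma> pl M X Y"
    and theta: "\<theta> \<in> feasible_Theta nC nR \<Theta> ph"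
    and gamma: "\<gamma> \<in> feasible_Gamma nC \<Gamma> pl"
    and agent: "i \<in> {1..N}"
    and obs: "y \<in> local_edges E i \<rightarrow>\<^sub>E r ` {1..nR}"
    and pos: "\<P>(\<omega> in M \<theta> \<gamma>. local_scores E i Y \<omega> = y) > 0"
    and u_def: "\<And>l. l \<in> {1..nC} \<Longrightarrow>
      u l = \<P>(\<omega> in M \<theta> \<gamma>. X i \<omega> = c l \<bar> local_scores E i Y \<omega> = y)"
    and pi_both_def: "\<And>l. l \<in> {1..nC} \<Longrightarrow>
      pi_both l = (\<Prod>h=1..nR. \<Prod>k=1..nR.
        (\<Sum>m=1..nC. ph k m l \<theta> * ph h l m \<theta> * pl m \<gamma>) ^ count_both E r y i h k)"
    and pi_in_def: "\<And>l. l \<in> {1..nC} \<Longrightarrow>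
      pi_in l = (\<Prod>h=1..nR. (\<Sum>m=1..nC. ph h m l \<theta> * pl m \<gamma>) ^ count_in E r y i h)"
    and pi_out_def: "\<And>l. l \<in> {1..nC} \<Longrightarrow>
      pi_out l = (\<Prod>h=1..nR. (\<Sum>m=1..nC. ph h l m \<theta> * pl m \<gamma>) ^ count_out E r y i h)"
    and v_def: "\<And>l. l \<in> {1..nC} \<Longrightarrow>
      v l = pl l \<gamma> * pi_both l * pi_in l * pi_out l"
    and Z_def: "Z = (\<Sum>l=1..nC. v l)"
  shows "\<forall>l\<in>{1..nC}. u l = v l / Z"
proof -
  interpret feasible_score_model N E nC c nR r \<Theta> ph \<Gamma> pl M X Y \<theta> \<gamma>
    by (intro feasible_score_model.intro model feasible_score_model_axioms.intro theta gamma)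
  \<comment> \<open>The indices of the observed scores; values of \<open>z\<close> off the local
    edges are never read.\<close>
  obtain z where z: "\<And>e. e \<in> local_edges E i \<Longrightarrow> z e \<in> {1..nR} \<and> y e = r (z e)"
  proof -
    have "\<forall>e\<in>local_edges E i. \<exists>h. h \<in> {1..nR} \<and> y e = r h"
      using PiE_mem[OF obs] by blast
    then show thesis using that by metis
  qed
  have y: "y \<in> extensional (local_edges E i)" using obs by (simp add: PiE_iff)
  \<comment> \<open>The weight \<open>v l\<close> is the numerator of the posterior itself, not
    merely proportional to it.\<close>
  have v: "v l = \<P>(\<omega> in M \<theta> \<gamma>. X i \<omega> = c l \<and> local_scores E i Y \<omega> = y)"
    if l: "l \<in> {1..nC}" for l
    using prob_state_local_scores[of i l z y] prod_neighbours[of i z y l] agent l z y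
    by (simp only: v_def[OF l] pi_both_def[OF l] pi_in_def[OF l] pi_out_def[OF l] mult.assoc)
  \<comment> \<open>Consequently \<open>Z\<close> is the probability of the observation, and
    \<open>v l / Z\<close> is the quotient that defines \<open>cond_prob\<close>.\<close>
  have "Z = \<P>(\<omega> in M \<theta> \<gamma>. local_scores E i Y \<omega> = y)"
    unfolding Z_def prob_local_scores[OF agent y] by (intro sum.cong refl v)
  then show ?thesis by (simp add: u_def v cond_prob_def)
qed

end
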